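(* Let $f:\mathbb{R}^n\to\mathbb{R}$ be convex and $L$-smooth ($L>0$) with a minimizer $x_\star$, let $x_0\in\mathbb{R}^n$ with $f(x_0)>f(x_\star)$, and suppose $D=\sup\{\|x-x_\star\|_2 \mid f(x)\le f(x_0)\}<\infty$. Let $h=(h_0,\dots,h_{t-1})\in\mathbb{R}^t$ be $\epsilon$-straightforward with parameter $\Delta\in(0,1/2]$, where $\epsilon\ge 0$ and $\mathrm{avg}(h)>\epsilon$. Let $(x_k)$ be generated by $x_{k+1}=x_k-\frac{h_{(k \bmod t)}}{L}\nabla f(x_k)$. Then for any $s\in\mathbb{N}$, after $T=st$ gradient steps, $$ f(x_T)-f(x_\star)\le \begin{cases} \left(1-\sum_{i=0}^{t-1}(h_i-\epsilon)\Delta\right)^s (f(x_0)-f(x_\star)) & \text{if } s\le \bar s,\\[4pt] \dfrac{LD^2}{(\mathrm{avg}(h)-\epsilon)(T-\bar s t)+\frac1\Delta} & \text{if } s>\bar s,\end{cases}$$ where $$\bar s=\left\lceil \frac{\log\left(\frac{LD^2\Delta}{f(x_0)-f(x_\star)}\right)}{\log\left(1-\sum_{i=0}^{t-1}(h_i-\epsilon)\Delta\right)}\right\rceil .$$ In particular, suppressing lower-order terms, $f(x_T)-f(x_\star)\le \frac{LD^2}{(\mathrm{avg}(h)-\epsilon)T}+O(1/T^2)$.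
   Context: $L$-smooth means differentiable with $L$-Lipschitz gradient (Euclidean norm). For $h\in\mathbb{R}^t$, $\mathrm{avg}(h)=\frac1t\sum_{i=0}^{t-1}h_i$. Worst-case value function: for a pattern $h\in\mathbb{R}^t$, problem dimension $n$, and $L,D>0$, $p_{L,D}(\delta)$ is the supremum of $f(x_t)-f(x_\star)$ over all convex $L$-smooth $f:\mathbb{R}^n\to\mathbb{R}$ and $x_0,x_\star\in\mathbb{R}^n$ with $\nabla f(x_\star)=0$, $\|x_0-x_\star\|_2\le D$, $f(x_0)-f(x_\star)\le\delta$, where $x_{k+1}=x_k-\frac{h_k}{L}\nabla f(x_k)$ for $k=0,\dots,t-1$ (value $-\infty$ if infeasible). $h$ is $\epsilon$-straightforward with parameter $\Delta\in(0,1/2]$ if, for any $L,D>0$, $p_{L,D}(\delta)\le \delta-\frac{\sum_{i=0}^{t-1}(h_i-\epsilon)}{LD^2}\delta^2$ for all $\delta\in[0,LD^2\Delta]$. Convention: "$f(x_T)-f(x_\star)\le \frac{LD^2}{cT}+O(1/T^2)$" abbreviates that there exist universal constants $s'$ and $C$ (depending only on the pattern, $\epsilon$ and $\Delta$) such that $f(x_T)-f(x_\star)\le \frac{LD^2}{cT-C}$ for all $T=st$ with $s>s'$. *)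

theory Defs
  imports "HOL-Analysis.Analysis"
begin

text \<open>
  The constants hidden in an \<open>O(1/T^2)\<close> bound have to be chosen before the dimension \<open>n\<close>, so the
  dimension must be a bound natural number rather than an index type. The spaces \<open>R^n\<close>
  are therefore realised, for all \<open>n\<close> at once, as the coordinate subspaces of the space of finitely
  supported real sequences with the Euclidean inner product. The type \<open>nat \<Rightarrow>\<^sub>0 real\<close> is not used
  for this because its library norm is the \<open>l^1\<close> norm.
\<close>

typedef finseq = "{x :: nat \<Rightarrow> real. finite {i. x i \<noteq> 0}}"
  morphisms coord Abs_finseq
  by (rule exI [of _ "\<lambda>_. 0"]) simp

setup_lifting type_definition_finseq

lemma finite_support_coord [simp]: "finite {i. coord x i \<noteq> 0}"
  using coord [of x] by simp

lemma finseq_eqI: "(\<And>i. coord x i = coord y i) \<Longrightarrow> x = y"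
  by (metis coord_inject ext)

instantiation finseq :: real_vector
begin

lift_definition zero_finseq :: finseq is "\<lambda>_. 0" by simp

lift_definition plus_finseq :: "finseq \<Rightarrow> finseq \<Rightarrow> finseq" is "\<lambda>x y i. x i + y i"
  subgoal for x y
    by (rule finite_subset [of _ "{i. x i \<noteq> 0} \<union> {i. y i \<noteq> 0}"]) auto
  done

lift_definition minus_finseq :: "finseq \<Rightarrow> finseq \<Rightarrow> finseq" is "\<lambda>x y i. x i - y i"
  subgoal for x y
    by (rule finite_subset [of _ "{i. x i \<noteq> 0} \<union> {i. y i \<noteq> 0}"]) auto
  done

lift_definition uminus_finseq :: "finseq \<Rightarrow> finseq" is "\<lambda>x i. - x i" by simp

lift_definition scaleR_finseq :: "real \<Rightarrow> finseq \<Rightarrow> finseq" is "\<lambda>r x i. r * x i"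
  subgoal for r x
    by (rule finite_subset [of _ "{i. x i \<noteq> 0}"]) auto
  done

instance
  by standard (transfer; simp add: algebra_simps fun_eq_iff)+

end

lemma coord_zero [simp]: "coord 0 i = 0"
  and coord_add [simp]: "coord (x + y) i = coord x i + coord y i"
  and coord_diff [simp]: "coord (x - y) i = coord x i - coord y i"
  and coord_uminus [simp]: "coord (- x) i = - coord x i"
  and coord_scaleR [simp]: "coord (r *\<^sub>R x) i = r * coord x i"
  by (transfer; simp)+

instantiation finseq :: real_inner
begin

definition inner_finseq :: "finseq \<Rightarrow> finseq \<Rightarrow> real" where
  "inner_finseq x y = (\<Sum>i | coord x i \<noteq> 0. coord x i * coord y i)"

definition norm_finseq :: "finseq \<Rightarrow> real" where
  "norm_finseq x = sqrt (x \<bullet> x)"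

definition dist_finseq :: "finseq \<Rightarrow> finseq \<Rightarrow> real" where
  "dist_finseq x y = norm (x - y)"

definition sgn_finseq :: "finseq \<Rightarrow> finseq" where
  "sgn_finseq x = x /\<^sub>R norm x"

definition uniformity_finseq :: "(finseq \<times> finseq) filter" where
  "uniformity_finseq = (INF e\<in>{0 <..}. principal {(x, y). dist x y < e})"

definition open_finseq :: "finseq set \<Rightarrow> bool" where
  "open_finseq U \<longleftrightarrow> (\<forall>x\<in>U. eventually (\<lambda>(x', y). x' = x \<longrightarrow> y \<in> U) uniformity)"

lemma inner_finseq_superset:
  assumes "finite I" "{i. coord x i \<noteq> 0} \<subseteq> I"
  shows "x \<bullet> y = (\<Sum>i\<in>I. coord x i * coord y i)"
  unfolding inner_finseq_def
  by (rule sum.mono_neutral_left) (use assms in auto)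

instance
proof
  fix x y z :: finseq and r :: real
  let ?S = "\<lambda>x. {i. coord x i \<noteq> 0}"
  have "x \<bullet> y = (\<Sum>i\<in>?S x \<union> ?S y. coord x i * coord y i)"
    by (rule inner_finseq_superset) auto
  also have "\<dots> = (\<Sum>i\<in>?S x \<union> ?S y. coord y i * coord x i)"
    by (simp only: mult.commute)
  also have "\<dots> = y \<bullet> x"
    by (rule inner_finseq_superset [symmetric]) auto
  finally show "x \<bullet> y = y \<bullet> x" .
  have "(x + y) \<bullet> z = (\<Sum>i\<in>?S x \<union> ?S y. coord (x + y) i * coord z i)"
    by (rule inner_finseq_superset) auto
  also have "\<dots> = (\<Sum>i\<in>?S x \<union> ?S y. coord x i * coord z i)
      + (\<Sum>i\<in>?S x \<union> ?S y. coord y i * coord z i)"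
    by (simp add: distrib_right sum.distrib)
  also have "(\<Sum>i\<in>?S x \<union> ?S y. coord x i * coord z i) = x \<bullet> z"
    by (rule inner_finseq_superset [symmetric]) auto
  also have "(\<Sum>i\<in>?S x \<union> ?S y. coord y i * coord z i) = y \<bullet> z"
    by (rule inner_finseq_superset [symmetric]) auto
  finally show "(x + y) \<bullet> z = x \<bullet> z + y \<bullet> z" .
  have "(r *\<^sub>R x) \<bullet> y = (\<Sum>i\<in>?S x. coord (r *\<^sub>R x) i * coord y i)"
    by (rule inner_finseq_superset) auto
  also have "\<dots> = r * (x \<bullet> y)"
    by (simp add: inner_finseq_def sum_distrib_left mult.assoc)
  finally show "(r *\<^sub>R x) \<bullet> y = r * (x \<bullet> y)" .
  show "0 \<le> x \<bullet> x"
    unfolding inner_finseq_def by (rule sum_nonneg) simp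
  show "x \<bullet> x = 0 \<longleftrightarrow> x = 0"
  proof
    assume "x \<bullet> x = 0"
    then have "\<forall>i\<in>?S x. coord x i * coord x i = 0"
      unfolding inner_finseq_def by (subst (asm) sum_nonneg_eq_0_iff) auto
    then show "x = 0"
      by (intro finseq_eqI) auto
  qed (simp add: inner_finseq_def)
qed (fact norm_finseq_def dist_finseq_def sgn_finseq_def uniformity_finseq_def open_finseq_def)+

end

definition Rn :: "nat \<Rightarrow> finseq set" where
  "Rn n = {x. \<forall>i\<ge>n. coord x i = 0}"

text \<open>
  Functions on \<open>R^n\<close> are given by functions on \<^typ>\<open>finseq\<close> whose values outside \<^term>\<open>Rn n\<close> are
  irrelevant: derivatives are taken within \<^term>\<open>Rn n\<close>, and requiring the representing vector to lie
  in \<^term>\<open>Rn n\<close> makes the gradient unique.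
\<close>

definition grad :: "nat \<Rightarrow> (finseq \<Rightarrow> real) \<Rightarrow> finseq \<Rightarrow> finseq" where
  "grad n f x =
     (THE g. g \<in> Rn n \<and> (f has_derivative (\<lambda>v. g \<bullet> v)) (at x within Rn n))"

definition L_smooth :: "nat \<Rightarrow> real \<Rightarrow> (finseq \<Rightarrow> real) \<Rightarrow> bool" where
  "L_smooth n L f \<longleftrightarrow> f differentiable_on Rn n \<and> L-lipschitz_on (Rn n) (grad n f)"

text \<open>A pattern \<open>h\<close> in \<open>R^t\<close> is a list of length \<open>t\<close>; it is repeated periodically. For
  the first \<open>t\<close> steps the reduction modulo \<open>t\<close> has no effect.\<close>

primrec gd_iterate ::
    "nat \<Rightarrow> real list \<Rightarrow> real \<Rightarrow> (finseq \<Rightarrow> real) \<Rightarrow> finseq \<Rightarrow> nat \<Rightarrow> finseq" where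
  "gd_iterate n h L f x0 0 = x0"
| "gd_iterate n h L f x0 (Suc k) =
     gd_iterate n h L f x0 k
       - (h ! (k mod length h) / L) *\<^sub>R grad n f (gd_iterate n h L f x0 k)"

definition avg :: "real list \<Rightarrow> real" where
  "avg h = (\<Sum>i<length h. h ! i) / real (length h)"

text \<open>The supremum is taken in \<^typ>\<open>ereal\<close>, where the supremum of the empty set is \<^term>\<open>-\<infinity> :: ereal\<close>.\<close>

definition worst_case :: "nat \<Rightarrow> real list \<Rightarrow> real \<Rightarrow> real \<Rightarrow> real \<Rightarrow> ereal" where
  "worst_case n h L D \<delta> =
     Sup {ereal (f (gd_iterate n h L f x0 (length h)) - f xs) | f x0 xs.
            convex_on (Rn n) f \<and> L_smooth n L f \<and> x0 \<in> Rn n \<and> xs \<in> Rn n \<and>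
            grad n f xs = 0 \<and> norm (x0 - xs) \<le> D \<and> f x0 - f xs \<le> \<delta>}"

definition straightforward :: "nat \<Rightarrow> real list \<Rightarrow> real \<Rightarrow> real \<Rightarrow> bool" where
  "straightforward n h \<epsilon> \<Delta> \<longleftrightarrow>
     0 < \<Delta> \<and> \<Delta> \<le> 1 / 2 \<and>
     (\<forall>L>0. \<forall>D>0. \<forall>\<delta>\<in>{0..L * D\<^sup>2 * \<Delta>}.
        worst_case n h L D \<delta>
          \<le> ereal (\<delta> - (\<Sum>i<length h. h ! i - \<epsilon>) / (L * D\<^sup>2) * \<delta>\<^sup>2))"

definition sublevel_dists :: "nat \<Rightarrow> (finseq \<Rightarrow> real) \<Rightarrow> finseq \<Rightarrow> finseq \<Rightarrow> real set" where
  "sublevel_dists n f x0 xs = {norm (x - xs) | x. x \<in> Rn n \<and> f x \<le> f x0}"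

definition smooth_problem ::
    "nat \<Rightarrow> real \<Rightarrow> real \<Rightarrow> (finseq \<Rightarrow> real) \<Rightarrow> finseq \<Rightarrow> finseq \<Rightarrow> bool" where
  "smooth_problem n L D f x0 xs \<longleftrightarrow>
     L > 0 \<and> convex_on (Rn n) f \<and> L_smooth n L f \<and>
     xs \<in> Rn n \<and> (\<forall>x\<in>Rn n. f xs \<le> f x) \<and>
     x0 \<in> Rn n \<and> f x0 > f xs \<and>
     bdd_above (sublevel_dists n f x0 xs) \<and> D = Sup (sublevel_dists n f x0 xs)"

text \<open>No clipping: the value is negative if the initial gap \<open>\<delta>\<^sub>0\<close> is sufficiently small.\<close>

definition s_bar ::
    "real list \<Rightarrow> real \<Rightarrow> real \<Rightarrow> real \<Rightarrow> real \<Rightarrow> real \<Rightarrow> int" where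
  "s_bar h \<epsilon> \<Delta> L D \<delta>\<^sub>0 =
     \<lceil>ln (L * D\<^sup>2 * \<Delta> / \<delta>\<^sub>0) / ln (1 - (\<Sum>i<length h. h ! i - \<epsilon>) * \<Delta>)\<rceil>"

end

theory Submission
  imports Defs
begin

text \<open>
  With \<open>S = \<Sum>i. h i - \<epsilon>\<close>, let \<open>u k\<close> be the gap after \<open>k\<close> periods, divided by \<open>L D\<^sup>2\<close>.
  While \<open>u k \<le> v \<le> \<Delta>\<close>, straightforwardness gives \<open>u (k + 1) \<le> v - S v\<^sup>2\<close>, so \<open>1 / u\<close> grows by at
  least \<open>S\<close> per period. For \<open>v \<ge> \<Delta>\<close> straightforwardness is applied with the larger distance bound
  for which \<open>v\<close> lies exactly on the boundary of the admissible range; this gives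
  \<open>u (k + 1) \<le> (1 - S \<Delta>) v\<close>. Hence the gap never increases, the iterates stay
  in the initial sublevel set, and both phases can be iterated.
  Smoothness gives \<open>u 0 \<le> 1 / 2\<close>, which bounds the length of the first phase uniformly.
\<close>

section \<open>Gradients on coordinate subspaces\<close>

lift_definition unit_vec :: "nat \<Rightarrow> finseq" is "\<lambda>i j. if j = i then 1 else 0"
  by simp

lemma coord_unit_vec: "coord (unit_vec i) j = (if j = i then 1 else 0)"
  by transfer simp

lemma coord_sum: "coord (sum F A) i = (\<Sum>a\<in>A. coord (F a) i)"
  by (induction A rule: infinite_finite_induct) auto

lemma add_in_Rn: "x \<in> Rn n \<Longrightarrow> y \<in> Rn n \<Longrightarrow> x + y \<in> Rn n"
  by (simp add: Rn_def)

lemma diff_in_Rn: "x \<in> Rn n \<Longrightarrow> y \<in> Rn n \<Longrightarrow> x - y \<in> Rn n"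
  by (simp add: Rn_def)

lemma scaleR_in_Rn: "x \<in> Rn n \<Longrightarrow> r *\<^sub>R x \<in> Rn n"
  by (simp add: Rn_def)

lemma Rn_expansion:
  assumes "x \<in> Rn n"
  shows "x = (\<Sum>i<n. coord x i *\<^sub>R unit_vec i)"
proof (rule finseq_eqI)
  fix j
  show "coord x j = coord (\<Sum>i<n. coord x i *\<^sub>R unit_vec i) j"
    using assms by (auto simp: coord_sum coord_unit_vec Rn_def if_distrib cong: if_cong)
qed

lemma inner_unit_vec: "unit_vec i \<bullet> x = coord x i"
  by (subst inner_finseq_superset [of "{i}"]) (auto simp: coord_unit_vec split: if_splits)

text \<open>The ambient space is infinite-dimensional and incomplete, so representation is carried
  out on a coordinate subspace, where the values of \<phi> on the unit vectors serve as
  coordinates.\<close>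

lemma Rn_riesz:
  assumes "linear \<phi>"
  shows "\<exists>g\<in>Rn n. \<forall>v\<in>Rn n. g \<bullet> v = (\<phi> v :: real)"
proof
  let ?g = "\<Sum>i<n. \<phi> (unit_vec i) *\<^sub>R unit_vec i"
  show "?g \<in> Rn n"
    by (auto simp: Rn_def coord_sum coord_unit_vec)
  show "\<forall>v\<in>Rn n. ?g \<bullet> v = \<phi> v"
  proof
    fix v assume "v \<in> Rn n"
    then have "\<phi> v = \<phi> (\<Sum>i<n. coord v i *\<^sub>R unit_vec i)"
      using Rn_expansion by metis
    also have "\<dots> = (\<Sum>i<n. coord v i * \<phi> (unit_vec i))"
      using assms by (simp add: linear_sum linear_scale)
    also have "\<dots> = ?g \<bullet> v"
      by (simp add: inner_sum_left inner_unit_vec mult.commute)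
    finally show "?g \<bullet> v = \<phi> v" by simp
  qed
qed

text \<open>Reduces gradients to one-variable calculus: the whole line lies in \<open>Rn n\<close>,
  so the derivative within the subspace restricts to an ordinary two-sided derivative in
  \<open>t\<close>.\<close>

lemma has_derivative_line:
  assumes "(f has_derivative (\<lambda>v. g \<bullet> v)) (at (x + t *\<^sub>R v) within Rn n)"
    and "x \<in> Rn n" "v \<in> Rn n"
  shows "((\<lambda>t. f (x + t *\<^sub>R v)) has_real_derivative g \<bullet> v) (at t)"
proof -
  have line: "((\<lambda>t. x + t *\<^sub>R v) has_derivative (\<lambda>r. r *\<^sub>R v)) (at t within UNIV)"
    by (auto intro!: derivative_eq_intros)
  have "range (\<lambda>t. x + t *\<^sub>R v) \<subseteq> Rn n"
    using assms by (auto intro!: add_in_Rn scaleR_in_Rn)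
  then have "(f has_derivative (\<lambda>v. g \<bullet> v)) (at (x + t *\<^sub>R v) within range (\<lambda>t. x + t *\<^sub>R v))"
    using assms(1) has_derivative_subset by blast
  from has_derivative_in_compose [OF line this]
  show ?thesis
    by (simp add: has_field_derivative_def mult_commute_abs mult.commute)
qed

text \<open>Justifies the description operator in \<open>grad\<close>. Uniqueness holds because two
  candidates have the same directional derivative along their own difference, which forces that
  difference to have norm zero.\<close>

lemma grad_characterization:
  assumes "f differentiable_on Rn n" "x \<in> Rn n"
  shows "grad n f x \<in> Rn n \<and> (f has_derivative (\<lambda>v. grad n f x \<bullet> v)) (at x within Rn n)"
proof -
  obtain \<phi> where \<phi>: "(f has_derivative \<phi>) (at x within Rn n)"
    using assms by (auto simp: differentiable_on_def differentiable_def)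
  then have "linear \<phi>"
    by (simp add: has_derivative_def bounded_linear.linear)
  from Rn_riesz [OF this] obtain g where g: "g \<in> Rn n" "\<And>v. v \<in> Rn n \<Longrightarrow> g \<bullet> v = \<phi> v"
    by blast
  \<comment> \<open>Off \<open>Rn n\<close> the functional \<phi> may differ from \<open>g\<close>,
    but the limit only sees increments \<open>y - x\<close> in \<open>Rn n\<close>.\<close>
  have "(f has_derivative (\<lambda>v. g \<bullet> v)) (at x within Rn n)"
    unfolding has_derivative_within
  proof
    show "bounded_linear (\<lambda>v. g \<bullet> v)"
      by (rule bounded_linear_inner_right)
    show "((\<lambda>y. (1 / norm (y - x)) *\<^sub>R (f y - (f x + g \<bullet> (y - x)))) \<longlongrightarrow> 0) (at x within Rn n)"
    proof (rule Lim_transform_eventually)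
      show "((\<lambda>y. (1 / norm (y - x)) *\<^sub>R (f y - (f x + \<phi> (y - x)))) \<longlongrightarrow> 0) (at x within Rn n)"
        using \<phi> by (simp add: has_derivative_within)
      show "\<forall>\<^sub>F y in at x within Rn n. (1 / norm (y - x)) *\<^sub>R (f y - (f x + \<phi> (y - x)))
          = (1 / norm (y - x)) *\<^sub>R (f y - (f x + g \<bullet> (y - x)))"
        using assms(2) g(2) by (auto simp: eventually_at_filter diff_in_Rn)
    qed
  qed
  moreover have "g1 = g2"
    if "g1 \<in> Rn n \<and> (f has_derivative (\<lambda>v. g1 \<bullet> v)) (at x within Rn n)"
      "g2 \<in> Rn n \<and> (f has_derivative (\<lambda>v. g2 \<bullet> v)) (at x within Rn n)" for g1 g2
  proof -
    have "((\<lambda>t. f (x + t *\<^sub>R (g1 - g2))) has_real_derivative g1 \<bullet> (g1 - g2)) (at 0)"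
      "((\<lambda>t. f (x + t *\<^sub>R (g1 - g2))) has_real_derivative g2 \<bullet> (g1 - g2)) (at 0)"
      using that assms(2) by (auto intro!: has_derivative_line diff_in_Rn)
    then have "g1 \<bullet> (g1 - g2) = g2 \<bullet> (g1 - g2)"
      by (rule DERIV_unique)
    then have "(g1 - g2) \<bullet> (g1 - g2) = 0"
      by (simp add: inner_diff_left)
    then show ?thesis by simp
  qed
  ultimately have "\<exists>!g. g \<in> Rn n \<and> (f has_derivative (\<lambda>v. g \<bullet> v)) (at x within Rn n)"
    using g(1) by blast
  then show ?thesis
    unfolding grad_def by (rule theI')
qed

lemma grad_in_Rn: "f differentiable_on Rn n \<Longrightarrow> x \<in> Rn n \<Longrightarrow> grad n f x \<in> Rn n"
  using grad_characterization by blast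

lemma grad_line_derivative:
  assumes "f differentiable_on Rn n" "x \<in> Rn n" "v \<in> Rn n"
  shows "((\<lambda>t. f (x + t *\<^sub>R v)) has_real_derivative grad n f (x + t *\<^sub>R v) \<bullet> v) (at t)"
  using assms grad_characterization [OF assms(1), of "x + t *\<^sub>R v"]
  by (auto intro!: has_derivative_line add_in_Rn scaleR_in_Rn)

text \<open>Bridges \<open>smooth_problem\<close>, which speaks of a minimizer, and
  \<open>worst_case\<close>, which asks for a zero gradient. The derivative along the gradient
  itself is its squared norm.\<close>

lemma grad_minimizer_eq_0:
  assumes "f differentiable_on Rn n" "xs \<in> Rn n" "\<And>x. x \<in> Rn n \<Longrightarrow> f xs \<le> f x"
  shows "grad n f xs = 0"
proof -
  let ?g = "grad n f xs"
  have g: "?g \<in> Rn n"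
    using assms grad_in_Rn by blast
  have "((\<lambda>t. f (xs + t *\<^sub>R ?g)) has_real_derivative ?g \<bullet> ?g) (at 0)"
    using grad_line_derivative [OF assms(1,2) g, of 0] by simp
  then have "?g \<bullet> ?g = 0"
    by (rule DERIV_local_min [of _ _ _ 1]) (use assms g in \<open>auto intro!: add_in_Rn scaleR_in_Rn\<close>)
  then show ?thesis by simp
qed

lemma L_smooth_quadratic_bound:
  assumes "L_smooth n L f" "xs \<in> Rn n" "x \<in> Rn n" "grad n f xs = 0"
  shows "f x - f xs \<le> L / 2 * (norm (x - xs))\<^sup>2"
proof -
  define v where "v = x - xs"
  have v: "v \<in> Rn n"
    using assms by (simp add: v_def diff_in_Rn)
  have diff: "f differentiable_on Rn n" and lip: "L-lipschitz_on (Rn n) (grad n f)"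
    using assms(1) by (auto simp: L_smooth_def)
  \<comment> \<open>The Lipschitz bound and Cauchy-Schwarz make \<psi> nonincreasing on [0, 1];
    comparing its endpoints gives the claim.\<close>
  define \<psi> where "\<psi> t = f (xs + t *\<^sub>R v) - L / 2 * t\<^sup>2 * (norm v)\<^sup>2" for t
  have "\<psi> 1 \<le> \<psi> 0"
  proof (rule DERIV_nonpos_imp_nonincreasing [of 0 1 \<psi>])
    fix t :: real assume t: "0 \<le> t" "t \<le> 1"
    let ?g = "grad n f (xs + t *\<^sub>R v)"
    have "(\<psi> has_real_derivative ?g \<bullet> v - L * t * (norm v)\<^sup>2) (at t)"
      unfolding \<psi>_def
      by (rule derivative_eq_intros grad_line_derivative [OF diff assms(2) v] refl)+ simp
    moreover have "?g \<bullet> v \<le> L * t * (norm v)\<^sup>2"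
    proof -
      have "dist ?g (grad n f xs) \<le> L * dist (xs + t *\<^sub>R v) xs"
        using lip assms(2) v by (auto intro!: lipschitz_onD add_in_Rn scaleR_in_Rn)
      then have "norm ?g \<le> L * (t * norm v)"
        using t assms(4) by (simp add: dist_norm)
      then have "norm ?g * norm v \<le> L * (t * norm v) * norm v"
        by (rule mult_right_mono) simp
      with norm_cauchy_schwarz [of ?g v] show ?thesis
        by (simp add: power2_eq_square mult.assoc)
    qed
    ultimately show "\<exists>y. (\<psi> has_real_derivative y) (at t) \<and> y \<le> 0"
      by (meson diff_le_0_iff_le)
  qed simp
  then show ?thesis
    by (simp add: \<psi>_def v_def)
qed

section \<open>One period of gradient descent\<close>

lemma gd_iterate_in_Rn:
  assumes "f differentiable_on Rn n" "x0 \<in> Rn n"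
  shows "gd_iterate n h L f x0 k \<in> Rn n"
  using assms by (induction k) (auto intro!: diff_in_Rn scaleR_in_Rn grad_in_Rn)

text \<open>Restarting after whole periods shifts the step index by a multiple of
  \<open>length h\<close>, so each period is a fresh run of the pattern, as
  \<open>worst_case\<close> requires.\<close>

lemma gd_iterate_period:
  "gd_iterate n h L f (gd_iterate n h L f x0 (s * length h)) k
     = gd_iterate n h L f x0 (s * length h + k)"
  by (induction k) auto

text \<open>\<open>D\<close> and \<delta> need only bound the actual distance and gap from above;
  the linear phase exploits this freedom by enlarging \<open>D\<close>.\<close>

lemma straightforward_step:
  assumes "straightforward n h \<epsilon> \<Delta>" "L > 0" "D > 0" "0 \<le> \<delta>" "\<delta> \<le> L * D\<^sup>2 * \<Delta>"
    and "convex_on (Rn n) f" "L_smooth n L f" "x0 \<in> Rn n" "xs \<in> Rn n" "grad n f xs = 0"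
    and "norm (x0 - xs) \<le> D" "f x0 - f xs \<le> \<delta>"
  shows "f (gd_iterate n h L f x0 (length h)) - f xs
    \<le> \<delta> - (\<Sum>i<length h. h ! i - \<epsilon>) / (L * D\<^sup>2) * \<delta>\<^sup>2"
proof -
  have "ereal (f (gd_iterate n h L f x0 (length h)) - f xs) \<le> worst_case n h L D \<delta>"
    unfolding worst_case_def using assms by (intro Sup_upper) blast
  also have "\<dots> \<le> ereal (\<delta> - (\<Sum>i<length h. h ! i - \<epsilon>) / (L * D\<^sup>2) * \<delta>\<^sup>2)"
    using assms(1-5) by (auto simp: straightforward_def)
  finally show ?thesis by simp
qed

section \<open>The scalar recursion\<close>

text \<open>Both steps quantify over upper bounds \<open>v\<close> of \<open>u k\<close>, because
  \<open>v - S * v^2\<close> need not be increasing on [0, \<Delta>], so a bound on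
  \<open>u k\<close> could not simply be substituted.\<close>

locale two_phase_sequence =
  fixes u :: "nat \<Rightarrow> real" and S \<Delta> :: real
  assumes S_pos: "S > 0" and \<Delta>_pos: "\<Delta> > 0"
    and nonneg: "0 \<le> u k" and initial_pos: "0 < u 0"
    and quadratic_step: "u k \<le> v \<Longrightarrow> v \<le> \<Delta> \<Longrightarrow> u (Suc k) \<le> v - S * v\<^sup>2"
    and linear_step: "u k \<le> v \<Longrightarrow> \<Delta> \<le> v \<Longrightarrow> u (Suc k) \<le> (1 - S * \<Delta>) * v"
begin

abbreviation "q \<equiv> 1 - S * \<Delta>"

abbreviation "sb \<equiv> \<lceil>ln (\<Delta> / u 0) / ln q\<rceil>"

lemma q_nonneg: "0 \<le> q"
proof -
  have "0 \<le> u (Suc 0)"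
    by (rule nonneg)
  \<comment> \<open>The maximum makes the linear step applicable whether or not \<open>u 0\<close>
    exceeds \<Delta>.\<close>
  also have "\<dots> \<le> q * max (u 0) \<Delta>"
    by (rule linear_step) auto
  finally show ?thesis
    using initial_pos by (simp add: zero_le_mult_iff)
qed

lemma q_less_1: "q < 1"
  using S_pos \<Delta>_pos by simp

lemma decreasing: "u (Suc k) \<le> u k"
proof (cases "u k \<le> \<Delta>")
  case True
  then show ?thesis
    using quadratic_step [of k "u k"] S_pos by (smt (verit) mult_nonneg_nonneg zero_le_power2)
next
  case False
  then have "u (Suc k) \<le> q * u k"
    by (intro linear_step) auto
  also have "\<dots> \<le> 1 * u k"
    using q_less_1 nonneg by (intro mult_right_mono) auto
  finally show ?thesis by simp
qed

text \<open>The threshold condition concerns the geometric bound rather than \<open>u j\<close>, so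
  the argument survives if the sequence itself drops below \<Delta> early.\<close>

lemma linear_phase:
  assumes "\<And>j. j < k \<Longrightarrow> \<Delta> \<le> q ^ j * u 0"
  shows "u k \<le> q ^ k * u 0"
  using assms
proof (induction k)
  case (Suc k)
  then have "u (Suc k) \<le> q * (q ^ k * u 0)"
    by (intro linear_step) auto
  then show ?case by simp
qed simp

text \<open>\<open>a\<close> acts as a lower bound on the reciprocal of \<open>u m\<close>, in a
  form that also allows \<open>u m = 0\<close>.\<close>

lemma sublinear_phase:
  assumes "u m \<le> 1 / a" "1 / \<Delta> \<le> a"
  shows "u (m + k) \<le> 1 / (a + S * real k)"
proof (induction k)
  case 0
  then show ?case using assms by simp
next
  case (Suc k)
  define b where "b = a + S * real k"
  have b: "1 / \<Delta> \<le> b"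
    using assms(2) S_pos by (simp add: b_def add_increasing2)
  then have "b > 0"
    using \<Delta>_pos by (smt (verit) zero_less_divide_1_iff)
  have "1 / b \<le> \<Delta>"
    using b \<open>b > 0\<close> \<Delta>_pos by (simp add: field_simps)
  then have "u (Suc (m + k)) \<le> 1 / b - S * (1 / b)\<^sup>2"
    using Suc by (intro quadratic_step) (simp_all add: b_def)
  also have "\<dots> = (b - S) / b\<^sup>2"
    using \<open>b > 0\<close> by (simp add: field_simps power2_eq_square)
  \<comment> \<open>This is (b - S)(b + S) \<le> b^2.\<close>
  also have "\<dots> \<le> 1 / (b + S)"
    using \<open>b > 0\<close> S_pos by (simp add: field_simps power2_eq_square)
  finally show ?case
    by (simp add: b_def algebra_simps)
qed

lemma linear_phase_lower_bound:
  assumes "int j < sb"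
  shows "\<Delta> \<le> q ^ j * u 0"
proof -
  \<comment> \<open>For \<open>q = 0\<close> the conventions \<open>ln 0 = 0\<close> and
    \<open>x / 0 = 0\<close> give \<open>sb = 0\<close>, and no \<open>j\<close> lies below
    it.\<close>
  have "q > 0"
    using assms q_nonneg by (cases "q = 0") auto
  then have "ln q < 0"
    using q_less_1 by simp
  have "real j < ln (\<Delta> / u 0) / ln q"
    using assms by (simp add: less_ceiling_iff)
  then have "ln (\<Delta> / u 0) < real j * ln q"
    using \<open>ln q < 0\<close> by (simp add: field_simps)
  then have "ln (\<Delta> / u 0) < ln (q ^ j)"
    using \<open>q > 0\<close> by (simp add: ln_realpow)
  then have "\<Delta> / u 0 < q ^ j"
    using \<open>q > 0\<close> \<Delta>_pos initial_pos by (subst (asm) ln_less_cancel_iff) auto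
  then show ?thesis
    using initial_pos by (simp add: field_simps)
qed

lemma linear_phase_bound: "int s \<le> sb \<Longrightarrow> u s \<le> q ^ s * u 0"
  by (rule linear_phase) (simp add: linear_phase_lower_bound)

text \<open>Rounding the logarithmic quotient up ensures that the geometric bound has reached
  \<Delta> at index \<open>sb\<close>.\<close>

lemma sublinear_phase_start:
  assumes "q > 0" "sb \<ge> 0"
  shows "u (nat sb) \<le> \<Delta>"
proof -
  have "ln q < 0"
    using assms q_less_1 by simp
  have "ln (\<Delta> / u 0) / ln q \<le> real (nat sb)"
    using assms(2) by simp
  then have "real (nat sb) * ln q \<le> ln (\<Delta> / u 0)"
    using \<open>ln q < 0\<close> by (simp add: field_simps)
  then have "ln (q ^ nat sb) \<le> ln (\<Delta> / u 0)"
    using assms by (simp add: ln_realpow)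
  then have "q ^ nat sb \<le> \<Delta> / u 0"
    using assms \<Delta>_pos initial_pos by (subst (asm) ln_le_cancel_iff) auto
  then have "q ^ nat sb * u 0 \<le> \<Delta>"
    using initial_pos by (simp add: field_simps)
  moreover have "u (nat sb) \<le> q ^ nat sb * u 0"
    using assms(2) by (intro linear_phase_bound) simp
  ultimately show ?thesis by simp
qed

text \<open>For a negative \<open>sb\<close> the claimed bound is stronger than the one obtained from \<open>u 0 \<le> \<Delta>\<close>.\<close>

lemma negative_sb_start:
  assumes "sb < 0"
  shows "S * (- sb) + 1 / \<Delta> \<le> 1 / u 0"
proof -
  have "q > 0"
    using assms q_nonneg by (cases "q = 0") auto
  \<comment> \<open>The inequality ln x \<le> x - 1 is used twice: here for the denominator, and
    below for the numerator, with x = \<Delta> / u 0.\<close>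
  then have "ln q < 0" "ln q \<le> - (S * \<Delta>)"
    using q_less_1 ln_le_minus_one [of q] by auto
  have neg: "ln (\<Delta> / u 0) / ln q < 0"
    using assms by linarith
  then have "ln (\<Delta> / u 0) > 0"
    using \<open>ln q < 0\<close> by (simp add: divide_less_0_iff)
  have "- real_of_int sb \<le> - (ln (\<Delta> / u 0) / ln q)"
    by simp
  also have "\<dots> = ln (\<Delta> / u 0) / (- ln q)"
    by simp
  also have "\<dots> \<le> ln (\<Delta> / u 0) / (S * \<Delta>)"
    using \<open>ln (\<Delta> / u 0) > 0\<close> \<open>ln q < 0\<close> \<open>ln q \<le> - (S * \<Delta>)\<close> S_pos \<Delta>_pos
    by (intro divide_left_mono mult_pos_pos) auto
  also have "\<dots> \<le> (\<Delta> / u 0 - 1) / (S * \<Delta>)"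
    using S_pos \<Delta>_pos initial_pos by (intro divide_right_mono ln_le_minus_one) auto
  finally have "S * (- sb) \<le> S * ((\<Delta> / u 0 - 1) / (S * \<Delta>))"
    using S_pos by (intro mult_left_mono) auto
  also have "\<dots> = 1 / u 0 - 1 / \<Delta>"
    using S_pos \<Delta>_pos initial_pos by (simp add: field_simps)
  finally show ?thesis by simp
qed

lemma sublinear_phase_bound:
  assumes "int s > sb"
  shows "u s \<le> 1 / (S * (real s - sb) + 1 / \<Delta>)"
proof -
  have start_in_range: ?thesis if "u (nat sb) \<le> \<Delta>" "sb \<ge> 0"
  proof -
    have "u (nat sb + (s - nat sb)) \<le> 1 / (1 / \<Delta> + S * real (s - nat sb))"
      using that by (intro sublinear_phase) auto
    moreover have "nat sb + (s - nat sb) = s" "real (s - nat sb) = real s - sb"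
      using assms that(2) by linarith+
    ultimately show ?thesis
      by (simp add: add.commute)
  qed
  \<comment> \<open>A negative \<open>sb\<close> would be lost in \<open>nat sb\<close>, so that
    case starts at index 0 with the exact reciprocal \<open>1 / u 0\<close>. For
    \<open>q = 0\<close> the threshold is 0, which says nothing about whether \<open>u 0\<close> is
    below \<Delta>.\<close>
  consider "sb < 0" | "sb \<ge> 0" "q > 0" | "q = 0" "u 0 \<le> \<Delta>" | "q = 0" "u 0 > \<Delta>"
    using q_nonneg by linarith
  then show ?thesis
  proof cases
    case 1
    have a: "S * (- sb) + 1 / \<Delta> \<le> 1 / u 0"
      using 1 by (rule negative_sb_start)
    have "0 \<le> S * (- sb)"
      using 1 S_pos by (intro mult_nonneg_nonneg) auto
    then have "1 / \<Delta> \<le> 1 / u 0"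
      using a by linarith
    then have "u (0 + s) \<le> 1 / (1 / u 0 + S * real s)"
      by (intro sublinear_phase) auto
    also have "\<dots> \<le> 1 / (S * (real s - sb) + 1 / \<Delta>)"
    proof (rule divide_left_mono)
      show "S * (real s - sb) + 1 / \<Delta> \<le> 1 / u 0 + S * real s"
        using a by (simp add: algebra_simps)
      have "0 < 1 / u 0 + S * real s"
        using initial_pos S_pos by (intro add_pos_nonneg) auto
      moreover have "0 < S * (real s - sb) + 1 / \<Delta>"
        using 1 S_pos \<Delta>_pos by (intro add_pos_pos mult_pos_pos divide_pos_pos) linarith+
      ultimately show "0 < (1 / u 0 + S * real s) * (S * (real s - sb) + 1 / \<Delta>)"
        by (rule mult_pos_pos)
    qed simp
    finally show ?thesis by (simp only: add_0)
  next
    case 2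
    then show ?thesis
      using sublinear_phase_start start_in_range by blast
  next
    case 3
    then show ?thesis
      by (intro start_in_range) auto
  next
    \<comment> \<open>\<open>ln 0 = 0\<close> and \<open>x / 0 = 0\<close> make \<open>sb = 0\<close>, and the linear phase ends in the minimum after one
      period.\<close>
    case 4
    then have "s \<ge> 1"
      using assms by auto
    then have "u s \<le> u 1"
      by (rule lift_Suc_antimono_le [of u, OF decreasing])
    also have "\<dots> \<le> q * u 0"
      using 4 linear_step [of 0 "u 0"] by simp
    also have "\<dots> = 0"
      using 4 by simp
    also have "0 \<le> 1 / (S * (real s - sb) + 1 / \<Delta>)"
      using assms S_pos \<Delta>_pos by (intro divide_nonneg_nonneg add_nonneg_nonneg mult_nonneg_nonneg) auto
    finally show ?thesis .
  qed
qed

text \<open>Removes the dependence of the threshold on the initial gap: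
  \<open>u 0 \<le> 1 / 2\<close> gives \<Delta> / u 0 \<ge> 2\<Delta>, and division by the negative
  \<open>ln q\<close> reverses the order.\<close>

lemma sb_le:
  assumes "u 0 \<le> 1 / 2"
  shows "sb \<le> \<lceil>ln (2 * \<Delta>) / ln q\<rceil>"
proof (cases "q = 0")
  case False
  then have "ln q < 0"
    using q_nonneg q_less_1 by simp
  have "\<Delta> * (2 * u 0) \<le> \<Delta> * 1"
    using assms \<Delta>_pos by (intro mult_left_mono) auto
  then have "2 * \<Delta> \<le> \<Delta> / u 0"
    using initial_pos by (simp add: field_simps)
  then have "ln (2 * \<Delta>) \<le> ln (\<Delta> / u 0)"
    using \<Delta>_pos initial_pos by (subst ln_le_cancel_iff) auto
  then show ?thesis
    using \<open>ln q < 0\<close> by (intro ceiling_mono divide_right_mono_neg) auto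
qed auto

text \<open>Replacing \<open>sb\<close> by a larger threshold only shrinks the denominator, which
  stays positive for \<open>s\<close> beyond it. The subtracted constant depends on \<open>S\<close>
  and \<Delta> alone.\<close>

lemma uniform_bound:
  assumes "u 0 \<le> 1 / 2" and "s > nat \<lceil>ln (2 * \<Delta>) / ln q\<rceil>"
  shows "u s \<le> 1 / (S * real s - (S * real (nat \<lceil>ln (2 * \<Delta>) / ln q\<rceil>) - 1 / \<Delta>))"
proof -
  let ?m = "nat \<lceil>ln (2 * \<Delta>) / ln q\<rceil>"
  have sb: "sb \<le> int ?m"
    using sb_le [OF assms(1)] by linarith
  have pos: "0 < S * (real s - real ?m) + 1 / \<Delta>"
    using assms(2) S_pos \<Delta>_pos by (intro add_pos_pos mult_pos_pos) auto
  have le: "S * (real s - real ?m) + 1 / \<Delta> \<le> S * (real s - sb) + 1 / \<Delta>"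
    using sb S_pos by (intro add_right_mono mult_left_mono) linarith+
  have "u s \<le> 1 / (S * (real s - sb) + 1 / \<Delta>)"
    using sb assms(2) by (intro sublinear_phase_bound) linarith
  also have "\<dots> \<le> 1 / (S * (real s - real ?m) + 1 / \<Delta>)"
    using pos le by (intro divide_left_mono mult_pos_pos) linarith+
  finally show ?thesis
    by (simp add: algebra_simps)
qed

end

section \<open>Gradient descent with a straightforward pattern\<close>

text \<open>Dividing by L D^2 removes the instance from the recursion. \<open>D\<close> bounds only
  distances in the initial sublevel set, so \<open>quad\<close> and \<open>lin\<close> carry a
  membership premise until \<open>in_sublevel\<close> discharges it.\<close>

lemma gd_two_phase_sequence:
  assumes "straightforward n h \<epsilon> \<Delta>" "smooth_problem n L D f x0 xs"
    and "(\<Sum>i<length h. h ! i - \<epsilon>) > 0"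
  defines "u \<equiv> \<lambda>s. (f (gd_iterate n h L f x0 (s * length h)) - f xs) / (L * D\<^sup>2)"
  shows "L > 0" "D > 0" "u 0 \<le> 1 / 2"
    and "two_phase_sequence u (\<Sum>i<length h. h ! i - \<epsilon>) \<Delta>"
proof -
  let ?S = "\<Sum>i<length h. h ! i - \<epsilon>" and ?x = "\<lambda>s. gd_iterate n h L f x0 (s * length h)"
  have L: "L > 0" and conv: "convex_on (Rn n) f" and smooth: "L_smooth n L f"
    and xs: "xs \<in> Rn n" and min: "\<And>x. x \<in> Rn n \<Longrightarrow> f xs \<le> f x"
    and x0: "x0 \<in> Rn n" "f x0 > f xs"
    and bdd: "bdd_above (sublevel_dists n f x0 xs)" and D: "D = Sup (sublevel_dists n f x0 xs)"
    using assms(2) by (auto simp: smooth_problem_def)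
  have diff: "f differentiable_on Rn n"
    using smooth by (simp add: L_smooth_def)
  have x_in: "?x s \<in> Rn n" for s
    using diff x0(1) by (rule gd_iterate_in_Rn)
  have norm_le: "norm (x - xs) \<le> D" if "x \<in> Rn n" "f x \<le> f x0" for x
    unfolding D using that bdd by (intro cSup_upper) (auto simp: sublevel_dists_def)
  have \<Delta>: "\<Delta> > 0"
    using assms(1) by (simp add: straightforward_def)
  show "L > 0" by fact
  have "0 < norm (x0 - xs)"
    using x0(2) by auto
  then show D_pos: "D > 0"
    using norm_le [OF x0(1)] by linarith
  have K: "L * D\<^sup>2 > 0"
    using L D_pos by simp
  have grad0: "grad n f xs = 0"
    using diff xs min by (rule grad_minimizer_eq_0)
  have "f x0 - f xs \<le> L / 2 * (norm (x0 - xs))\<^sup>2"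
    using smooth xs x0(1) grad0 by (rule L_smooth_quadratic_bound)
  also have "\<dots> \<le> L / 2 * D\<^sup>2"
    using L norm_le [OF x0(1)] by (intro mult_left_mono power_mono) auto
  finally show u0: "u 0 \<le> 1 / 2"
    using K by (simp add: u_def field_simps)
  have quad: "u (Suc s) \<le> v - ?S * v\<^sup>2" if "f (?x s) \<le> f x0" "u s \<le> v" "v \<le> \<Delta>" for s v
  proof -
    have "f (?x s) - f xs \<le> L * D\<^sup>2 * v"
      using that(2) K by (simp add: u_def field_simps)
    moreover have "0 \<le> u s"
      using min [OF x_in] K by (simp add: u_def)
    then have "0 \<le> L * D\<^sup>2 * v"
      using that(2) K by (intro mult_nonneg_nonneg [OF less_imp_le]) auto
    moreover have "L * D\<^sup>2 * v \<le> L * D\<^sup>2 * \<Delta>"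
      using that(3) K by (intro mult_left_mono) auto
    ultimately have "f (gd_iterate n h L f (?x s) (length h)) - f xs
        \<le> L * D\<^sup>2 * v - ?S / (L * D\<^sup>2) * (L * D\<^sup>2 * v)\<^sup>2"
      using straightforward_step [OF assms(1) L D_pos _ _ conv smooth x_in xs grad0
          norm_le [OF x_in that(1)]] by blast
    also have "\<dots> = L * D\<^sup>2 * (v - ?S * v\<^sup>2)"
      using K by (simp add: power2_eq_square field_simps)
    finally show ?thesis
      using K by (simp add: u_def gd_iterate_period add.commute pos_divide_le_eq mult.commute)
  qed
  have lin: "u (Suc s) \<le> (1 - ?S * \<Delta>) * v" if "f (?x s) \<le> f x0" "u s \<le> v" "\<Delta> \<le> v" for s v
  proof -
    define \<delta> where "\<delta> = L * D\<^sup>2 * v"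
    \<comment> \<open>Chosen so that L D'^2 \<Delta> = \<delta>. As v \<ge> \<Delta>, this is at
      least \<open>D\<close>, and the quadratic term becomes
      \<open>?S * \<Delta> * \<delta>\<close>, which yields the linear factor.\<close>
    define D' where "D' = sqrt (\<delta> / (L * \<Delta>))"
    have "\<delta> > 0"
      using K \<Delta> that(3) by (auto simp: \<delta>_def intro!: mult_pos_pos)
    then have D': "D' > 0" "L * D'\<^sup>2 * \<Delta> = \<delta>"
      using L \<Delta> by (auto simp: D'_def)
    have "D\<^sup>2 * \<Delta> \<le> D\<^sup>2 * v"
      using that(3) by (intro mult_left_mono) auto
    then have "D\<^sup>2 \<le> \<delta> / (L * \<Delta>)"
      using L \<Delta> by (simp add: \<delta>_def field_simps)
    then have "D \<le> D'"
      unfolding D'_def by (rule real_le_rsqrt)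
    then have norm': "norm (?x s - xs) \<le> D'"
      using norm_le [OF x_in that(1)] by linarith
    have gap: "f (?x s) - f xs \<le> \<delta>"
      using that(2) K by (simp add: u_def \<delta>_def field_simps)
    have "L * D'\<^sup>2 = \<delta> / \<Delta>"
      using D'(2) \<Delta> by (simp add: field_simps)
    then have "?S / (L * D'\<^sup>2) * \<delta>\<^sup>2 = ?S * \<Delta> * \<delta>"
      using \<open>\<delta> > 0\<close> by (simp add: power2_eq_square)
    moreover have "f (gd_iterate n h L f (?x s) (length h)) - f xs
        \<le> \<delta> - ?S / (L * D'\<^sup>2) * \<delta>\<^sup>2"
      using straightforward_step [OF assms(1) L D'(1) _ _ conv smooth x_in xs grad0 norm' gap]
        \<open>\<delta> > 0\<close> D'(2) by simp
    ultimately have "f (?x (Suc s)) - f xs \<le> (1 - ?S * \<Delta>) * v * (L * D\<^sup>2)"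
      by (simp add: gd_iterate_period add.commute \<delta>_def algebra_simps)
    then show ?thesis
      using K by (simp add: u_def pos_divide_le_eq)
  qed
  have nonneg: "0 \<le> u s" for s
    using min [OF x_in] K by (simp add: u_def)
  have in_sublevel: "f (?x s) \<le> f x0" for s
  proof (induction s)
    case (Suc s)
    \<comment> \<open>Membership at \<open>s\<close> licenses one step with \<open>v = u s\<close>;
      the resulting decrease gives membership at \<open>Suc s\<close>.\<close>
    have "u (Suc s) \<le> u s"
    proof (cases "u s \<le> \<Delta>")
      case True
      have "0 \<le> ?S * (u s)\<^sup>2"
        using assms(3) by simp
      then show ?thesis
        using quad [OF Suc order.refl True] by linarith
    next
      case False
      have "0 \<le> ?S * \<Delta> * u s"
        using assms(3) \<Delta> nonneg by simp
      then show ?thesis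
        using lin [OF Suc order.refl] False by (simp add: algebra_simps)
    qed
    then have "f (?x (Suc s)) \<le> f (?x s)"
      using K by (simp add: u_def divide_le_cancel)
    then show ?case using Suc by linarith
  qed simp
  show "two_phase_sequence u ?S \<Delta>"
  proof
    show "0 < u 0"
      using x0(2) K by (simp add: u_def)
  qed (use assms(3) \<Delta> nonneg quad lin in_sublevel in auto)
qed

section \<open>Return from scaled gaps to function values\<close>

theorem theorem2p1:
  fixes h :: "real list" and \<epsilon> \<Delta> :: real
  assumes "\<epsilon> \<ge> 0" and "avg h > \<epsilon>"
  shows "(\<forall>n L D f x0 xs (s::nat).
            straightforward n h \<epsilon> \<Delta> \<longrightarrow> smooth_problem n L D f x0 xs \<longrightarrow>
            (let t = length h; T = s * t;
                 sb = s_bar h \<epsilon> \<Delta> L D (f x0 - f xs);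
                 xT = gd_iterate n h L f x0 T
             in (int s \<le> sb \<longrightarrow>
                   f xT - f xs \<le> (1 - (\<Sum>i<t. h ! i - \<epsilon>) * \<Delta>) ^ s * (f x0 - f xs)) \<and>
                (int s > sb \<longrightarrow>
                   f xT - f xs
                     \<le> L * D\<^sup>2 / ((avg h - \<epsilon>) * (real T - real_of_int sb * real t) + 1 / \<Delta>))))
       \<and> (\<exists>(s'::nat) (C::real). \<forall>n L D f x0 xs (s::nat).
            straightforward n h \<epsilon> \<Delta> \<longrightarrow> smooth_problem n L D f x0 xs \<longrightarrow> s > s' \<longrightarrow>
            (let T = s * length h
             in f (gd_iterate n h L f x0 T) - f xs \<le> L * D\<^sup>2 / ((avg h - \<epsilon>) * real T - C)))"
proof -
  define S where "S = (\<Sum>i<length h. h ! i - \<epsilon>)"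
  \<comment> \<open>The empty pattern has average 0 / 0 = 0, which cannot exceed \<epsilon> \<ge>
    0.\<close>
  have t: "length h > 0"
    using assms by (cases h) (auto simp: avg_def)
  have S: "S = (avg h - \<epsilon>) * real (length h)"
    using t by (simp add: S_def avg_def sum_subtractf field_simps)
  have S_pos: "S > 0"
    using assms t by (simp add: S)
  show ?thesis
  proof (intro conjI allI impI)
    fix n L D f x0 xs and s :: nat
    assume *: "straightforward n h \<epsilon> \<Delta>" "smooth_problem n L D f x0 xs"
    define u where "u s = (f (gd_iterate n h L f x0 (s * length h)) - f xs) / (L * D\<^sup>2)" for s
    note facts = gd_two_phase_sequence [OF * S_pos [unfolded S_def], folded S_def u_def]
    interpret two_phase_sequence u S \<Delta>
      by (rule facts)
    have K: "L * D\<^sup>2 > 0"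
      using facts by simp
    \<comment> \<open>The scale L D^2 cancels inside the logarithm.\<close>
    have sb: "s_bar h \<epsilon> \<Delta> L D (f x0 - f xs) = sb"
      using K by (simp add: s_bar_def S_def [symmetric] u_def mult.commute)
    have gap: "f (gd_iterate n h L f x0 (s * length h)) - f xs = L * D\<^sup>2 * u s" for s
      using facts(1,2) by (simp add: u_def)
    have gap0: "f x0 - f xs = L * D\<^sup>2 * u 0"
      using gap [of 0] by simp
    have denom: "(avg h - \<epsilon>) * (real (s * length h) - real_of_int sb * real (length h))
        = S * (real s - real_of_int sb)"
      by (simp add: S algebra_simps)
    have "L * D\<^sup>2 * u s \<le> q ^ s * (L * D\<^sup>2 * u 0)" if "int s \<le> sb"
      using mult_left_mono [OF linear_phase_bound [OF that], of "L * D\<^sup>2"] K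
      by (simp add: mult.left_commute)
    moreover have "L * D\<^sup>2 * u s \<le> L * D\<^sup>2 / (S * (real s - real_of_int sb) + 1 / \<Delta>)" if "int s > sb"
      using mult_left_mono [OF sublinear_phase_bound [OF that], of "L * D\<^sup>2"] K by simp
    ultimately show "let t = length h; T = s * t;
                 sb = s_bar h \<epsilon> \<Delta> L D (f x0 - f xs);
                 xT = gd_iterate n h L f x0 T
             in (int s \<le> sb \<longrightarrow>
                   f xT - f xs \<le> (1 - (\<Sum>i<t. h ! i - \<epsilon>) * \<Delta>) ^ s * (f x0 - f xs)) \<and>
                (int s > sb \<longrightarrow>
                   f xT - f xs
                     \<le> L * D\<^sup>2 / ((avg h - \<epsilon>) * (real T - real_of_int sb * real t) + 1 / \<Delta>))"
      unfolding Let_def sb unfolding S_def [symmetric] denom gap gap0 by blast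
  next
    let ?m = "nat \<lceil>ln (2 * \<Delta>) / ln (1 - S * \<Delta>)\<rceil>"
    show "\<exists>(s'::nat) (C::real). \<forall>n L D f x0 xs (s::nat).
            straightforward n h \<epsilon> \<Delta> \<longrightarrow> smooth_problem n L D f x0 xs \<longrightarrow> s > s' \<longrightarrow>
            (let T = s * length h
             in f (gd_iterate n h L f x0 T) - f xs \<le> L * D\<^sup>2 / ((avg h - \<epsilon>) * real T - C))"
    \<comment> \<open>The witnesses stay schematic until the assumption on \<open>s\<close> and the
      final \<open>show\<close> fix them as \<open>?m\<close> and
      \<open>S * real ?m - 1 / \<Delta>\<close>; both depend only on the pattern, \<epsilon> and
      \<Delta>.\<close>
    proof (intro exI allI impI)
      fix n L D f x0 xs and s :: nat
      assume *: "straightforward n h \<epsilon> \<Delta>" "smooth_problem n L D f x0 xs" and s: "s > ?m"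
      define u where "u s = (f (gd_iterate n h L f x0 (s * length h)) - f xs) / (L * D\<^sup>2)" for s
      note facts = gd_two_phase_sequence [OF * S_pos [unfolded S_def], folded S_def u_def]
      interpret two_phase_sequence u S \<Delta>
        by (rule facts)
      have K: "L * D\<^sup>2 > 0"
        using facts by simp
      have gap: "f (gd_iterate n h L f x0 (s * length h)) - f xs = L * D\<^sup>2 * u s"
        using facts(1,2) by (simp add: u_def)
      have denom: "(avg h - \<epsilon>) * real (s * length h) = S * real s"
        by (simp add: S algebra_simps)
      show "let T = s * length h
             in f (gd_iterate n h L f x0 T) - f xs
               \<le> L * D\<^sup>2 / ((avg h - \<epsilon>) * real T - (S * real ?m - 1 / \<Delta>))"
        unfolding Let_def gap denom
        using mult_left_mono [OF uniform_bound [OF facts(3) s], of "L * D\<^sup>2"] K by simp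
    qed
  qed
qed

end
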